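(* Let $A\in\mathbb{R}^{m\times n}$, $b\in\mathbb{R}^m$, $J=\mathrm{diag}(I_p,-I_q)$ with $p+q=m$, and suppose $M=A^TJA$ is positive definite. Let $x=M^{-1}A^TJb$ be the unique solution of the indefinite least squares (ILS) problem $\min_{x\in\mathbb{R}^n}(b-Ax)^TJ(b-Ax)$ and let $r=b-Ax$. Let $L\in\mathbb{R}^{n\times k}$ with $\mathrm{rank}(L)=k$ and let $\Phi,\beta,\xi_L$ be positive real numbers. Then the 2-norm projected condition number of the ILS problem (defined in the context) is $$\kappa_{2L\mathcal{F}_{ils}}(A,b)=\left\|\xi_LL^T\left[\tfrac{1}{\Phi}\Gamma_J,\ \tfrac{1}{\beta}M^{-1}A^TJ\right]\right\|_2,\qquad \Gamma_J=M^{-1}\otimes(Jr)^T-x^T\otimes(M^{-1}A^TJ),$$ and it is equal to each of the two expressions (in the second, $x\ne0$ is understood so that $\mathcal{P}_x$ is defined) $$\kappa_{2L\mathcal{F}_{ils1}}(A,b)=\left\|\xi_L^2L^TM^{-1}\left(\tfrac{\zeta^2}{\Phi^2\beta^2}A^TA+\tfrac{\|r\|_2^2}{\Phi^2}I_n-\tfrac{1}{\Phi^2}(xr^TA+A^Trx^T)\right)M^{-1}L\right\|_2^{1/2},$$ $$\kappa_{2L\mathcal{F}_{ils2}}(A,b)=\left\|\xi_LL^TM^{-1}\begin{bmatrix}\frac{\zeta}{\Phi\beta}A^T-\frac{\beta}{\zeta\Phi}xr^T, & \frac{\|r\|_2}{\zeta}I_n, & \frac{\beta\|r\|_2\|x\|_2}{\zeta\Phi}\mathcal{P}_x\end{bmatrix}\right\|_2,$$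 where $\zeta=\sqrt{\beta^2\|x\|_2^2+\Phi^2}$ and $\mathcal{P}_x=I_n-\frac{1}{\|x\|_2^2}xx^T$.
   Context: $\otimes$ is the Kronecker product $X\otimes Y=[x_{ij}Y]$; $\|\cdot\|_2$ is the Euclidean/spectral norm. The solution map near the data is $\mathcal{F}(A,b)=(A^TJA)^{-1}A^TJb$, and $\mathcal{F}_L=L^T\mathcal{F}$. The 2-norm projected condition number of the ILS problem is $$\kappa_{2L\mathcal{F}_{ils}}(A,b)=\lim_{\delta\to0^+}\ \sup_{0<\|(\Phi\Delta A,\beta\Delta b)\|_F\le\delta}\frac{\xi_L\|\mathcal{F}_L(A+\Delta A,b+\Delta b)-\mathcal{F}_L(A,b)\|_2}{\|(\Phi\Delta A,\beta\Delta b)\|_F},$$ where $\|(\Phi\Delta A,\beta\Delta b)\|_F=\sqrt{\Phi^2\|\Delta A\|_F^2+\beta^2\|\Delta b\|_2^2}$. *)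

theory Defs
  imports "HOL-Analysis.Analysis"
begin

text \<open>The matrix \<open>diag(I\<^sub>p, -I\<^sub>q)\<close>, where \<open>q\<close> is the number of remaining indices. The
  order on the index type serves only to say which \<open>p\<close> diagonal positions come first;
  unlike an index type \<open>'p + 'q\<close>, this encoding also covers \<open>p = 0\<close> and \<open>q = 0\<close>.\<close>

definition signature_matrix :: "nat \<Rightarrow> real^'m::{finite,wellorder}^'m::_" where
  "signature_matrix p =
     (\<chi> i j. if i = j then (if card {k. k < i} < p then 1 else - 1) else 0)"

definition pos_def :: "real^'n^'n \<Rightarrow> bool" where
  "pos_def M \<longleftrightarrow> transpose M = M \<and> (\<forall>v. v \<noteq> 0 \<longrightarrow> v \<bullet> (M *v v) > 0)"

definition spectral_norm :: "real^'n^'m \<Rightarrow> real" where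
  "spectral_norm X = onorm (\<lambda>v. X *v v)"

text \<open>Kronecker product \<open>[x\<^sub>i\<^sub>j Y]\<close>: the first component of an index pair selects the
  block, the second the position inside that block.\<close>

definition kron :: "real^'n^'m \<Rightarrow> real^'l^'k \<Rightarrow> real^('n \<times> 'l)^('m \<times> 'k)" where
  "kron X Y = (\<chi> i j. X $ fst i $ fst j * Y $ snd i $ snd j)"

definition block_row :: "real^'n^'m \<Rightarrow> real^'l^'m \<Rightarrow> real^('n + 'l)^'m" where
  "block_row X Y = (\<chi> i j. case j of Inl s \<Rightarrow> X $ i $ s | Inr t \<Rightarrow> Y $ i $ t)"

definition outer :: "real^'n \<Rightarrow> real^'m \<Rightarrow> real^'m^'n" where
  "outer u v = (columnvector u :: real^1^'n) ** (rowvector v :: real^'m^1)"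

definition ils_objective :: "real^'m^'m \<Rightarrow> real^'n^'m \<Rightarrow> real^'m \<Rightarrow> real^'n \<Rightarrow> real" where
  "ils_objective J A b x = (b - A *v x) \<bullet> (J *v (b - A *v x))"

definition ils_map :: "real^'m^'m \<Rightarrow> real^'n^'m \<Rightarrow> real^'m \<Rightarrow> real^'n" where
  "ils_map J A b = matrix_inv (transpose A ** J ** A) *v (transpose A *v (J *v b))"

text \<open>\<open>norm\<close> on \<open>real^'n^'m\<close> is the Frobenius norm.\<close>

definition weighted_norm :: "real \<Rightarrow> real \<Rightarrow> real^'n^'m \<Rightarrow> real^'m \<Rightarrow> real" where
  "weighted_norm \<Phi> \<beta> dA db = sqrt (\<Phi>\<^sup>2 * (norm dA)\<^sup>2 + \<beta>\<^sup>2 * (norm db)\<^sup>2)"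

text \<open>The supremum and the limit are taken in \<open>ereal\<close>: for large \<open>\<delta>\<close> the perturbed matrix
  may be singular and the quotients unbounded, and a supremum in \<open>real\<close> would then be
  unspecified. The supremum is monotone in \<open>\<delta>\<close>, so the limit always exists.\<close>

definition projected_cond_ils ::
  "real \<Rightarrow> real \<Rightarrow> real \<Rightarrow> real^'k^'n \<Rightarrow> real^'m^'m \<Rightarrow> real^'n^'m \<Rightarrow> real^'m \<Rightarrow> ereal" where
  "projected_cond_ils \<Phi> \<beta> \<xi> L J A b =
     Lim (at_right (0::real)) (\<lambda>\<delta>.
       SUP (dA, db) \<in> {(dA, db). 0 < weighted_norm \<Phi> \<beta> dA db \<and> weighted_norm \<Phi> \<beta> dA db \<le> \<delta>}.
         ereal (\<xi> * norm (transpose L *v ils_map J (A + dA) (b + db) - transpose L *v ils_map J A b)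
                  / weighted_norm \<Phi> \<beta> dA db))"

text \<open>\<open>M\<^sup>-\<^sup>1 \<otimes> (Jr)\<^sup>T - x\<^sup>T \<otimes> (M\<^sup>-\<^sup>1 A\<^sup>T J)\<close> with \<open>M = A\<^sup>T J A\<close>. The rows of the two
  products are indexed by \<open>'n \<times> 1\<close> and \<open>1 \<times> 'n\<close>; both are identified with \<open>'n\<close>.\<close>

definition Gamma_ils ::
  "real^'m^'m \<Rightarrow> real^'n^'m \<Rightarrow> real^'n \<Rightarrow> real^'m \<Rightarrow> real^('n \<times> 'm)^'n" where
  "Gamma_ils J A x r =
     (let Mi = matrix_inv (transpose A ** J ** A) in
      \<chi> i. kron Mi (rowvector (J *v r) :: real^'m^1) $ (i, 1)
         - kron (rowvector x :: real^'n^1) (Mi ** transpose A ** J) $ (1, i))"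

definition complement_projector :: "real^'n \<Rightarrow> real^'n^'n" where
  "complement_projector x = mat 1 - (1 / (norm x)\<^sup>2) *\<^sub>R outer x x"

end

(* The normal equation for perturbed data (A', b') gives ils_map (A', b') - x = M'^-1 g (A', b')
  with g (A', b') = A'^T J (b' - A' x) and g (A, b) = 0. As inversion is continuous, the
  solution map is differentiable at (A, b) with derivative M^-1 g', and no derivative of the
  inverse is needed. The condition number is the operator norm of this derivative after
  rescaling by the weights, and vectorization turns it into the spectral norm of the block matrix K.
  The other two expressions follow from |K| = |K K^T|^(1/2): with N = M^-1 A^T J, the identity
  J J = I gives N N^T = M^-1 A^T A M^-1 and N J r = M^-1 A^T r, and both K and the
  factor with the projector have the same Gram matrix. *)

theory Submission
  imports Defs
begin

section \<open>Continuity of matrix operations and of inversion\<close>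

lemma bounded_bilinear_matrix_vector_mult:
  "bounded_bilinear ((*v) :: real^'n^'m \<Rightarrow> real^'n \<Rightarrow> real^'m)"
  unfolding bilinear_conv_bounded_bilinear[symmetric] bilinear_def
  by (auto intro!: linearI simp: matrix_vector_mult_add_rdistrib scaleR_matrix_vector_assoc
      matrix_vector_right_distrib matrix_vector_mult_scaleR)

lemma bounded_linear_transpose:
  "bounded_linear (transpose :: real^'n^'m \<Rightarrow> real^'m^'n)"
  unfolding linear_conv_bounded_linear[symmetric]
  by (auto intro!: linearI simp: transpose_def vec_eq_iff)

lemma bounded_bilinear_matrix_matrix_mult:
  "bounded_bilinear ((**) :: real^'n^'m \<Rightarrow> real^'k^'n \<Rightarrow> real^'k^'m)"
  unfolding bilinear_conv_bounded_bilinear[symmetric] bilinear_def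
  by (auto intro!: linearI simp: matrix_matrix_mult_def vec_eq_iff algebra_simps sum.distrib
      sum_distrib_left)

lemma tendsto_det:
  fixes f :: "'a \<Rightarrow> real^'n^'n"
  assumes "(f \<longlongrightarrow> X) F"
  shows "((\<lambda>y. det (f y)) \<longlongrightarrow> det X) F"
  unfolding det_def by (intro tendsto_intros assms)

text \<open>Cramer's rule writes the inverse with determinants, which are polynomials in the
  entries. This is the source of its continuity.\<close>

lemma matrix_inv_mult_cramer:
  fixes X :: "real^'n^'n"
  assumes "det X \<noteq> 0"
  shows "matrix_inv X *v c = (\<chi> k. det (\<chi> i j. if j = k then c $ i else X $ i $ j) / det X)"
proof -
  have "invertible X"
    using assms by (simp add: invertible_det_nz)
  then have "X ** matrix_inv X = mat 1"
    unfolding invertible_def matrix_inv_def by (rule someI2_ex) auto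
  then have "X *v (matrix_inv X *v c) = c"
    by (simp add: matrix_vector_mul_assoc)
  then show ?thesis
    using cramer[OF assms] by blast
qed

text \<open>Cramer's formula is continuous in the matrix where \<open>det X\<close> is nonzero. It
  agrees with \<open>matrix_inv\<close> only at invertible matrices, so the two limits are matched
  on the eventual set where the determinant stays nonzero.\<close>

lemma tendsto_matrix_inv_mult:
  fixes f :: "'a \<Rightarrow> real^'n^'n"
  assumes f: "(f \<longlongrightarrow> X) F" and X: "invertible X"
  shows "((\<lambda>y. matrix_inv (f y) *v c) \<longlongrightarrow> matrix_inv X *v c) F"
proof -
  have dX: "det X \<noteq> 0"
    using X by (simp add: invertible_det_nz)
  have comp: "((\<lambda>y. f y $ i $ j) \<longlongrightarrow> X $ i $ j) F" for i j
    by (intro tendsto_intros f)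
  have "((\<lambda>y. \<chi> k. det (\<chi> i j. if j = k then c $ i else f y $ i $ j) / det (f y))
      \<longlongrightarrow> (\<chi> k. det (\<chi> i j. if j = k then c $ i else X $ i $ j) / det X)) F"
    using dX by (intro tendsto_vec_lambda tendsto_divide tendsto_det f) (auto intro: comp)
  moreover have "\<forall>\<^sub>F y in F. (\<chi> k. det (\<chi> i j. if j = k then c $ i else f y $ i $ j) / det (f y))
      = matrix_inv (f y) *v c"
    using tendsto_imp_eventually_ne[OF tendsto_det[OF f] dX]
    by eventually_elim (simp add: matrix_inv_mult_cramer)
  ultimately show ?thesis
    unfolding matrix_inv_mult_cramer[OF dX]
    by (rule Lim_transform_eventually)
qed

lemma tendsto_matrix_inv:
  fixes f :: "'a \<Rightarrow> real^'n^'n"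
  assumes f: "(f \<longlongrightarrow> X) F" and X: "invertible X"
  shows "((\<lambda>y. matrix_inv (f y)) \<longlongrightarrow> matrix_inv X) F"
proof (intro vec_tendstoI)
  fix i j
  have "((\<lambda>y. (matrix_inv (f y) *v axis j 1) $ i) \<longlongrightarrow> (matrix_inv X *v axis j 1) $ i) F"
    by (intro tendsto_vec_nth tendsto_matrix_inv_mult f X)
  then show "((\<lambda>y. matrix_inv (f y) $ i $ j) \<longlongrightarrow> matrix_inv X $ i $ j) F"
    by (simp add: matrix_vector_mult_basis column_def)
qed

section \<open>Derivative of a product and limits of difference quotients\<close>

text \<open>A product rule in which \<open>P\<close> is merely continuous at \<open>a\<close>. In
  the splitting \<open>bop (P a) (g y) + bop (P y - P a) (g y)\<close> the first summand has the
  stated derivative. The second is o(|y - a|): one factor tends to 0 and, because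
  \<open>g a = 0\<close>, the other is O(|y - a|).\<close>

lemma has_derivative_bilinear_vanishing:
  fixes g :: "'a::real_normed_vector \<Rightarrow> 'b::real_normed_vector"
  assumes "bounded_bilinear bop"
    and P: "(P \<longlongrightarrow> P a) (at a)" and g: "(g has_derivative g') (at a)" and g0: "g a = 0"
  shows "((\<lambda>y. bop (P y) (g y)) has_derivative (\<lambda>h. bop (P a) (g' h))) (at a)"
proof -
  interpret bounded_bilinear bop by fact
  obtain K where K: "K > 0" "\<And>u v. norm (bop u v) \<le> norm u * norm v * K"
    using pos_bounded by blast
  obtain B where B: "B > 0" "\<And>h. norm (g' h) \<le> norm h * B"
    using bounded_linear.pos_bounded[OF has_derivative_bounded_linear[OF g]] by blast
  have lin: "((\<lambda>y. bop (P a) (g y)) has_derivative (\<lambda>h. bop (P a) (g' h))) (at a)"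
    by (rule bounded_linear.has_derivative[OF bounded_linear_right g])
  \<comment> \<open>In the constant \<open>B + 1\<close>, the summand \<open>B\<close> bounds the
    derivative and 1 bounds the remainder, which is eventually smaller than |y - a|.\<close>
  have quot: "\<forall>\<^sub>F y in at a. norm (g y) \<le> (B + 1) * norm (y - a)"
  proof -
    have "((\<lambda>y. norm (g y - g a - g' (y - a)) / norm (y - a)) \<longlongrightarrow> 0) (at a)"
      using g by (simp add: has_derivative_iff_norm)
    then have "\<forall>\<^sub>F y in at a. norm (g y - g a - g' (y - a)) / norm (y - a) < 1"
      by (rule order_tendstoD) simp
    moreover have "\<forall>\<^sub>F y in at a. y \<noteq> a"
      by (simp add: eventually_at_filter)
    ultimately show ?thesis
    proof eventually_elim
      case (elim y)
      then have "norm (g y - g' (y - a)) < norm (y - a)"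
        by (simp add: g0 divide_less_eq)
      moreover have "norm (g y) \<le> norm (g y - g' (y - a)) + norm (g' (y - a))"
        using norm_triangle_sub by (metis add.commute)
      ultimately show ?case
        using B(2)[of "y - a"] by (simp add: algebra_simps)
    qed
  qed
  have "((\<lambda>y. bop (P y - P a) (g y)) has_derivative (\<lambda>h. 0)) (at a)"
    unfolding has_derivative_iff_norm
  proof (intro conjI)
    have "((\<lambda>y. norm (P y - P a) * ((B + 1) * K)) \<longlongrightarrow> 0 * ((B + 1) * K)) (at a)"
      using P by (intro tendsto_intros) (simp add: tendsto_norm_zero_iff LIM_zero_iff)
    then have lim: "((\<lambda>y. norm (P y - P a) * ((B + 1) * K)) \<longlongrightarrow> 0) (at a)"
      by simp
    show "((\<lambda>y. norm (bop (P y - P a) (g y) - bop (P a - P a) (g a) - 0) / norm (y - a)) \<longlongrightarrow> 0) (at a)"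
    proof (rule Lim_null_comparison[OF _ lim])
      show "\<forall>\<^sub>F y in at a. norm (norm (bop (P y - P a) (g y) - bop (P a - P a) (g a) - 0) / norm (y - a))
          \<le> norm (P y - P a) * ((B + 1) * K)"
        using quot
      proof eventually_elim
        case (elim y)
        have "norm (bop (P y - P a) (g y)) \<le> norm (P y - P a) * norm (g y) * K"
          by (rule K)
        also have "\<dots> \<le> norm (P y - P a) * ((B + 1) * norm (y - a)) * K"
          using K elim by (intro mult_right_mono mult_left_mono) auto
        finally have "norm (bop (P y - P a) (g y)) \<le> norm (P y - P a) * ((B + 1) * K) * norm (y - a)"
          by (simp add: mult_ac)
        then have "norm (bop (P y - P a) (g y)) / norm (y - a) \<le> norm (P y - P a) * ((B + 1) * K)"
          using K B by (cases "y = a") (auto simp: divide_le_eq)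
        then show ?case
          by (simp add: zero_left)
      qed
    qed
  qed simp
  from has_derivative_add[OF this lin] show ?thesis
    by (simp add: diff_left)
qed

text \<open>Links the limit of suprema in the definition of the condition number to an operator
  norm. From below, the quotients along a ray through \<open>a\<close> already approach |D h| / |h|,
  for every radius. From above, the remainder is small uniformly in the direction.\<close>

lemma SUP_difference_quotient_tendsto_onorm:
  fixes G :: "'a::euclidean_space \<Rightarrow> 'b::real_normed_vector"
  assumes G: "(G has_derivative D) (at a)"
  shows "((\<lambda>\<delta>. SUP h\<in>{h. 0 < norm h \<and> norm h \<le> \<delta>}. ereal (norm (G (a + h) - G a) / norm h))
    \<longlongrightarrow> ereal (onorm D)) (at_right 0)"
proof -
  define S where "S \<delta> = (SUP h\<in>{h::'a. 0 < norm h \<and> norm h \<le> \<delta>}. ereal (norm (G (a + h) - G a) / norm h))"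
    for \<delta>
  have D: "bounded_linear D"
    using G by (rule has_derivative_bounded_linear)
  interpret D: bounded_linear D by fact
  have q: "((\<lambda>h. norm (G (a + h) - G a - D h) / norm h) \<longlongrightarrow> 0) (at 0)"
    using G by (simp add: has_derivative_at)
  have lower: "ereal (onorm D) \<le> S \<delta>" if "\<delta> > 0" for \<delta>
  \<comment> \<open>\<open>S \<delta>\<close> may be infinite, so the comparison is made with each
    real upper bound \<open>z\<close> of it.\<close>
  proof (rule ereal_le_real)
    fix z assume z: "S \<delta> \<le> ereal z"
    have "norm (D h) \<le> z * norm h" for h :: 'a
    proof (cases "h = 0")
      case False
      \<comment> \<open>Shrinking \<open>h\<close> along its ray keeps |D h| / |h| fixed, while the
        remainder quotient tends to 0.\<close>
      have "filterlim (\<lambda>t. t *\<^sub>R h) (at 0) (at_right 0)"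
        unfolding filterlim_at
      proof (intro conjI)
        show "((\<lambda>t. t *\<^sub>R h) \<longlongrightarrow> 0) (at_right 0)"
          by (auto intro!: tendsto_eq_intros)
        show "\<forall>\<^sub>F t in at_right 0. t *\<^sub>R h \<in> UNIV \<and> t *\<^sub>R h \<noteq> 0"
          using False by (auto simp: eventually_at_filter)
      qed
      from filterlim_compose[OF q this]
      have "((\<lambda>t. norm (G (a + t *\<^sub>R h) - G a - D (t *\<^sub>R h)) / norm (t *\<^sub>R h)) \<longlongrightarrow> 0) (at_right 0)" .
      then have "((\<lambda>t. z + norm (G (a + t *\<^sub>R h) - G a - D (t *\<^sub>R h)) / norm (t *\<^sub>R h)) \<longlongrightarrow> z + 0) (at_right 0)"
        by (intro tendsto_intros)
      moreover have "\<forall>\<^sub>F t in at_right 0. norm (D h) / norm h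
          \<le> z + norm (G (a + t *\<^sub>R h) - G a - D (t *\<^sub>R h)) / norm (t *\<^sub>R h)"
      proof -
        have "\<forall>\<^sub>F t in at_right 0. t > 0 \<and> t < \<delta> / norm h"
          using that False eventually_at_right_real[of 0 "\<delta> / norm h"] by simp
        then show ?thesis
        proof eventually_elim
          case (elim t)
          define k where "k = t *\<^sub>R h"
          have k: "0 < norm k" "norm k \<le> \<delta>"
            using elim False by (auto simp: k_def pos_less_divide_eq)
          have "ereal (norm (G (a + k) - G a) / norm k) \<le> S \<delta>"
            unfolding S_def using k by (intro SUP_upper) auto
          with z have "norm (G (a + k) - G a) / norm k \<le> z"
            using order_trans by fastforce
          moreover have "norm (D k) \<le> norm (G (a + k) - G a) + norm (G (a + k) - G a - D k)"
            using norm_triangle_ineq4[of "G (a + k) - G a" "G (a + k) - G a - D k"] by simp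
          then have "norm (D k) / norm k \<le> norm (G (a + k) - G a) / norm k + norm (G (a + k) - G a - D k) / norm k"
            using k by (simp add: add_divide_distrib[symmetric] divide_right_mono)
          moreover have "norm (D k) / norm k = norm (D h) / norm h"
            using elim by (simp add: k_def D.scaleR)
          ultimately show ?case
            by (simp add: k_def)
        qed
      qed
      ultimately have "norm (D h) / norm h \<le> z + 0"
        by (intro tendsto_lowerbound[of _ "z + 0" "at_right 0"]) auto
      then show ?thesis
        using False by (simp add: pos_divide_le_eq)
    qed (simp add: D.zero)
    then show "ereal (onorm D) \<le> ereal z"
      by (simp add: onorm_le)
  qed
  have upper: "\<forall>\<^sub>F \<delta> in at_right 0. S \<delta> < y" if y: "ereal (onorm D) < y" for y
  proof -
    \<comment> \<open>As \<open>y\<close> may be infinite, a real \<open>z\<close> is put in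
      between. The gap \<open>z - onorm D\<close> is the room for the remainder, and the bound
      \<open>S \<delta> \<le> z\<close> keeps the inequality with \<open>y\<close> strict.\<close>
    obtain z where z: "ereal (onorm D) < ereal z" "ereal z < y"
      using y ereal_dense2 by blast
    from z have "0 < z - onorm D" by simp
    from order_tendstoD(2)[OF q this] obtain d where d: "d > 0"
      "\<And>h :: 'a. h \<noteq> 0 \<Longrightarrow> norm h < d \<Longrightarrow> norm (G (a + h) - G a - D h) / norm h < z - onorm D"
      by (auto simp: eventually_at)
    have "\<forall>\<^sub>F \<delta> in at_right 0. 0 < \<delta> \<and> \<delta> < d"
      using eventually_at_right_real[of 0 d] d by simp
    then show ?thesis
    proof eventually_elim
      case (elim \<delta>)
      have "S \<delta> \<le> ereal z"
        unfolding S_def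
      proof (rule SUP_least)
        fix h :: 'a assume "h \<in> {h. 0 < norm h \<and> norm h \<le> \<delta>}"
        then have h: "h \<noteq> 0" "norm h < d" using elim by auto
        have "norm (G (a + h) - G a) / norm h \<le> norm (G (a + h) - G a - D h) / norm h + norm (D h) / norm h"
          using norm_triangle_sub[of "G (a + h) - G a" "D h"]
          by (simp add: add_divide_distrib[symmetric] divide_right_mono add.commute)
        moreover have "norm (D h) / norm h \<le> onorm D"
          by (rule le_onorm[OF D])
        ultimately show "ereal (norm (G (a + h) - G a) / norm h) \<le> ereal z"
          using d(2)[OF h] by simp
      qed
      then show ?case using z by simp
    qed
  qed
  have "(S \<longlongrightarrow> ereal (onorm D)) (at_right 0)"
  proof (rule order_tendstoI)
    fix y assume "y < ereal (onorm D)"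
    have "\<forall>\<^sub>F \<delta> in at_right (0::real). \<delta> > 0"
      by (simp add: eventually_at_filter)
    then show "\<forall>\<^sub>F \<delta> in at_right 0. y < S \<delta>"
      by eventually_elim (use lower \<open>y < ereal (onorm D)\<close> in \<open>auto intro: less_le_trans\<close>)
  qed (rule upper)
  then show ?thesis
    unfolding S_def .
qed

text \<open>\<open>onorm\<close> is a supremum of quotients over the whole space, so a
  norm-preserving surjection only reparametrizes it. It serves to replace pairs of perturbations by
  vectors.\<close>

lemma onorm_compose_isometry:
  assumes "surj T" and "\<And>v. norm (T v) = norm v"
  shows "onorm (\<lambda>v. D (T v)) = onorm D"
proof -
  have "(\<lambda>v. norm (D v) / norm v) ` range T = range (\<lambda>v. norm (D (T v)) / norm v)"
    using assms(2) by (auto simp: image_image)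
  then show ?thesis
    using assms(1) by (simp add: onorm_def)
qed

section \<open>Spectral norm and Gram matrices\<close>

lemma spectral_norm_le:
  assumes "0 \<le> c" and "\<And>v. norm (X *v v) \<le> c * norm v"
  shows "spectral_norm X \<le> c"
  unfolding spectral_norm_def using assms by (rule onorm_bound)

lemma spectral_norm:
  "norm (X *v v) \<le> spectral_norm X * norm v"
  unfolding spectral_norm_def by (rule onorm) simp

lemma spectral_norm_nonneg: "0 \<le> spectral_norm X"
  unfolding spectral_norm_def by (rule onorm_pos_le) simp

lemma spectral_norm_transpose_le_sqrt:
  fixes X :: "real^'n^'m"
  shows "spectral_norm (transpose X) \<le> sqrt (spectral_norm (X ** transpose X))"
proof (rule spectral_norm_le)
  fix v :: "real^'m"
  have "(norm (transpose X *v v))\<^sup>2 = (transpose X *v v) \<bullet> (transpose X *v v)"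
    by (simp add: power2_norm_eq_inner)
  also have "\<dots> = v \<bullet> ((X ** transpose X) *v v)"
    by (metis dot_lmul_matrix matrix_vector_mul_assoc transpose_matrix_vector)
  also have "\<dots> \<le> norm v * norm ((X ** transpose X) *v v)"
    by (rule norm_cauchy_schwarz)
  also have "\<dots> \<le> norm v * (spectral_norm (X ** transpose X) * norm v)"
    by (intro mult_left_mono spectral_norm) simp
  also have "\<dots> = (sqrt (spectral_norm (X ** transpose X)) * norm v)\<^sup>2"
    by (simp add: power_mult_distrib spectral_norm_nonneg power2_eq_square[of "norm v"])
  finally show "norm (transpose X *v v) \<le> sqrt (spectral_norm (X ** transpose X)) * norm v"
    by (rule power2_le_imp_le) (simp add: spectral_norm_nonneg)
qed (simp add: spectral_norm_nonneg)

text \<open>For w = X^T v, Cauchy-Schwarz gives |w|^2 = v . (X w) \<le> |v| |X| |w|, and one factor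
  |w| cancels.\<close>

lemma spectral_norm_transpose_le:
  fixes X :: "real^'n^'m"
  shows "spectral_norm (transpose X) \<le> spectral_norm X"
proof (rule spectral_norm_le)
  fix v :: "real^'m"
  define w where "w = transpose X *v v"
  have "(norm w)\<^sup>2 = v \<bullet> (X *v w)"
    unfolding w_def by (metis dot_lmul_matrix power2_norm_eq_inner transpose_matrix_vector)
  also have "\<dots> \<le> norm v * (spectral_norm X * norm w)"
    by (rule order_trans[OF norm_cauchy_schwarz]) (intro mult_left_mono spectral_norm, simp)
  finally have "norm w * norm w \<le> norm w * (spectral_norm X * norm v)"
    by (simp add: power2_eq_square mult_ac)
  then have "norm w \<le> spectral_norm X * norm v"
    by (cases "w = 0") (auto simp: spectral_norm_nonneg)
  then show "norm (transpose X *v v) \<le> spectral_norm X * norm v"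
    by (simp add: w_def)
qed (rule spectral_norm_nonneg)

text \<open>The Gram matrix alone determines the norm. Hence matrices with different numbers of
  columns, such as the Kronecker form and the form with the projector, can be compared.\<close>

lemma spectral_norm_eq_sqrt:
  fixes X :: "real^'n^'m"
  shows "spectral_norm X = sqrt (spectral_norm (X ** transpose X))"
proof (rule antisym)
  show "spectral_norm X \<le> sqrt (spectral_norm (X ** transpose X))"
    using spectral_norm_transpose_le[of "transpose X"] spectral_norm_transpose_le_sqrt[of X] by simp
  have "spectral_norm (X ** transpose X) \<le> (spectral_norm X)\<^sup>2"
  proof (rule spectral_norm_le)
    fix v :: "real^'m"
    have "norm ((X ** transpose X) *v v) \<le> spectral_norm X * norm (transpose X *v v)"
      by (metis matrix_vector_mul_assoc spectral_norm)
    also have "\<dots> \<le> spectral_norm X * (spectral_norm X * norm v)"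
      by (intro mult_left_mono order_trans[OF spectral_norm] mult_right_mono
          spectral_norm_transpose_le) (auto simp: spectral_norm_nonneg)
    finally show "norm ((X ** transpose X) *v v) \<le> (spectral_norm X)\<^sup>2 * norm v"
      by (simp add: power2_eq_square mult_ac)
  qed simp
  then show "sqrt (spectral_norm (X ** transpose X)) \<le> spectral_norm X"
    by (simp add: real_le_lsqrt spectral_norm_nonneg)
qed

section \<open>Outer products, block rows and Kronecker factors\<close>

lemma transpose_diff: "transpose (X - Y) = transpose X - transpose (Y :: 'a::minus^'n^'m)"
  by (simp add: transpose_def vec_eq_iff)

lemma matrix_diff_ldistrib:
  fixes X :: "'a::ring_1^'n^'m"
  shows "X ** (Y - Z) = X ** Y - X ** Z"
  by (vector matrix_matrix_mult_def sum_subtractf[symmetric] right_diff_distrib)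

lemma matrix_diff_rdistrib:
  fixes X :: "'a::ring_1^'n^'m"
  shows "(X - Y) ** Z = X ** Z - Y ** Z"
  by (vector matrix_matrix_mult_def sum_subtractf[symmetric] left_diff_distrib)

lemma matrix_add_rdistrib:
  fixes X :: "'a::ring_1^'n^'m"
  shows "(X + Y) ** Z = X ** Z + Y ** Z"
  by (vector matrix_matrix_mult_def sum.distrib[symmetric] distrib_right)

lemma outer_nth: "outer u v $ i $ j = u $ i * v $ j"
  by (simp add: outer_def matrix_matrix_mult_def columnvector_def rowvector_def)

lemma transpose_outer: "transpose (outer u v) = outer v u"
  by (simp add: vec_eq_iff outer_nth transpose_def)

lemma matrix_mult_outer: "X ** outer u v = outer (X *v u) v"
  by (simp add: vec_eq_iff outer_nth matrix_matrix_mult_def matrix_vector_mult_def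
      sum_distrib_right mult.assoc)

lemma outer_mult_matrix: "outer u v ** X = outer u (v v* X)"
  by (simp add: vec_eq_iff outer_nth matrix_matrix_mult_def vector_matrix_mult_def
      sum_distrib_left mult_ac)

lemma outer_mult_outer: "outer u v ** outer v' w = (v \<bullet> v') *\<^sub>R outer u w"
  by (simp add: vec_eq_iff outer_nth matrix_matrix_mult_def inner_vec_def
      sum_distrib_left sum_distrib_right mult_ac)

lemma sum_UNIV_Plus:
  "sum f (UNIV :: ('a::finite + 'b::finite) set) = (\<Sum>i\<in>UNIV. f (Inl i)) + (\<Sum>j\<in>UNIV. f (Inr j))"
  by (simp add: UNIV_Plus_UNIV[symmetric] sum.Plus del: UNIV_Plus_UNIV)

lemma sum_UNIV_Times:
  "sum f (UNIV :: ('a::finite \<times> 'b::finite) set) = (\<Sum>i\<in>UNIV. \<Sum>j\<in>UNIV. f (i, j))"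
  by (simp add: UNIV_Times_UNIV[symmetric] sum.cartesian_product del: UNIV_Times_UNIV)

lemma block_row_mult_transpose:
  "block_row X Y ** transpose (block_row X Y) = X ** transpose X + Y ** transpose Y"
  by (simp add: vec_eq_iff matrix_matrix_mult_def block_row_def transpose_def sum_UNIV_Plus)

text \<open>An orthogonal projector is symmetric and idempotent, so it is its own Gram
  matrix.\<close>

lemma complement_projector_mult_transpose:
  assumes "x \<noteq> 0"
  shows "complement_projector x ** transpose (complement_projector x) = complement_projector x"
  using assms
  by (simp add: complement_projector_def transpose_diff transpose_scalar transpose_outer
      matrix_diff_ldistrib matrix_diff_rdistrib scalar_matrix_assoc[symmetric] matrix_scalar_ac
      outer_mult_outer power2_norm_eq_inner)

lemma Gamma_ils_nth:
  "Gamma_ils J A x r $ i $ (j, l) =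
    matrix_inv (transpose A ** J ** A) $ i $ j * (J *v r) $ l
    - x $ j * (matrix_inv (transpose A ** J ** A) ** transpose A ** J) $ i $ l"
  by (simp add: Gamma_ils_def Let_def kron_def rowvector_def)

text \<open>The Gram matrix of B \<otimes> s^T - x^T \<otimes> N. The hypothesis is entrywise, which
  avoids one-element index types. Each of the four products in the expanded double sum separates
  into a sum over \<open>j\<close> times a sum over \<open>l\<close>; the two mixed ones give the
  outer products.\<close>

lemma kron_difference_mult_transpose:
  fixes G :: "real^('n::finite \<times> 'm::finite)^'k"
  assumes G: "\<And>i j l. G $ i $ (j, l) = B $ i $ j * s $ l - x $ j * N $ i $ l"
  shows "G ** transpose G = (norm s)\<^sup>2 *\<^sub>R (B ** transpose B) - outer (B *v x) (N *v s)
    - outer (N *v s) (B *v x) + (norm x)\<^sup>2 *\<^sub>R (N ** transpose N)"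
proof -
  have prods: "(\<Sum>j\<in>UNIV. \<Sum>l\<in>UNIV. f j * g l) = (\<Sum>j\<in>UNIV. f j) * (\<Sum>l\<in>UNIV. g l)"
    for f :: "'n \<Rightarrow> real" and g :: "'m \<Rightarrow> real"
    by (simp add: sum_product)
  have "(\<Sum>j\<in>UNIV. \<Sum>l\<in>UNIV. G $ i $ (j, l) * G $ i' $ (j, l)) =
      (\<Sum>j\<in>UNIV. B $ i $ j * B $ i' $ j) * (\<Sum>l\<in>UNIV. s $ l * s $ l)
      - (\<Sum>j\<in>UNIV. B $ i $ j * x $ j) * (\<Sum>l\<in>UNIV. N $ i' $ l * s $ l)
      - (\<Sum>j\<in>UNIV. B $ i' $ j * x $ j) * (\<Sum>l\<in>UNIV. N $ i $ l * s $ l)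
      + (\<Sum>j\<in>UNIV. x $ j * x $ j) * (\<Sum>l\<in>UNIV. N $ i $ l * N $ i' $ l)" for i i'
    unfolding prods[symmetric] G
    by (simp add: sum_subtractf[symmetric] sum.distrib[symmetric] algebra_simps)
  then show ?thesis
    unfolding matrix_matrix_mult_def transpose_def
    by (simp add: vec_eq_iff sum_UNIV_Times outer_nth
        matrix_vector_mult_def power2_norm_eq_inner inner_vec_def mult_ac)
qed

section \<open>Inverses, definiteness and the signature matrix\<close>

lemma matrix_inv_self:
  fixes X :: "real^'n^'n"
  assumes "invertible X"
  shows "X ** matrix_inv X = mat 1" "matrix_inv X ** X = mat 1"
proof -
  have "X ** matrix_inv X = mat 1 \<and> matrix_inv X ** X = mat 1"
    using assms unfolding invertible_def matrix_inv_def by (rule someI_ex)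
  then show "X ** matrix_inv X = mat 1" "matrix_inv X ** X = mat 1" by auto
qed

text \<open>Transposing X^-1 X = I makes the transposed inverse a right inverse of the symmetric X,
  and inverses are unique.\<close>

lemma transpose_matrix_inv:
  fixes X :: "real^'n^'n"
  assumes "invertible X" "transpose X = X"
  shows "transpose (matrix_inv X) = matrix_inv X"
proof -
  have "X ** transpose (matrix_inv X) = mat 1"
    using matrix_inv_self(2)[OF assms(1)] assms(2)
    by (metis matrix_transpose_mul transpose_mat)
  then show ?thesis
    by (metis matrix_inv_self(2)[OF assms(1)] matrix_mul_assoc matrix_mul_lid matrix_mul_rid)
qed

lemma pos_def_invertible:
  assumes "pos_def X"
  shows "invertible X"
  unfolding invertible_left_inverse matrix_left_invertible_ker
proof (intro allI impI)
  fix v assume "X *v v = 0"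
  then have "\<not> 0 < v \<bullet> (X *v v)"
    by simp
  then show "v = 0"
    using assms unfolding pos_def_def by blast
qed

lemma transpose_signature_matrix: "transpose (signature_matrix p) = signature_matrix p"
  by (auto simp: signature_matrix_def transpose_def vec_eq_iff)

lemma signature_matrix_involution:
  "signature_matrix p ** signature_matrix p = (mat 1 :: real^'m::{finite,wellorder}^'m::_)"
proof -
  have "signature_matrix p $ i $ k * signature_matrix p $ k $ j
      = (if k = i then (if i = j then 1 else 0) else 0)" for i j k :: 'm
    by (simp add: signature_matrix_def)
  then show ?thesis
    by (simp add: matrix_matrix_mult_def mat_def vec_eq_iff)
qed

section \<open>Normal equation and the unique minimizer\<close>

lemma inner_matrix_vector_transpose:
  fixes A :: "real^'n^'m"
  shows "(A *v u) \<bullet> w = u \<bullet> (transpose A *v w)"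
  by (metis dot_lmul_matrix transpose_transpose transpose_matrix_vector)

text \<open>This is M x = A^T J b rearranged. It is used twice: it removes the cross terms in the
  expansion of the objective, and it makes the factor to be differentiated vanish at the
  data.\<close>

lemma ils_normal_equation:
  fixes A :: "real^'n^'m"
  assumes "invertible (transpose A ** J ** A)"
  shows "transpose A *v (J *v (b - A *v ils_map J A b)) = 0"
proof -
  define M where "M = transpose A ** J ** A"
  have "M *v ils_map J A b = transpose A *v (J *v b)"
    using matrix_inv_self(1)[OF assms]
    by (simp add: ils_map_def M_def matrix_vector_mul_assoc[of _ "matrix_inv _"]
        del: transpose_matrix_vector)
  then show ?thesis
    by (simp add: M_def matrix_vector_mult_diff_distrib matrix_vector_mul_assoc matrix_mul_assoc
        del: transpose_matrix_vector)
qed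

text \<open>Completing the square: by the normal equation J r is orthogonal to the range of A, so
  the objective at z exceeds its value at x by the positive definite form (z - x) . M (z -
  x).\<close>

lemma is_arg_min_ils_objective_iff:
  fixes A :: "real^'n^'m"
  assumes J: "transpose J = J" and pos: "pos_def (transpose A ** J ** A)"
  shows "is_arg_min (ils_objective J A b) (\<lambda>_. True) y \<longleftrightarrow> y = ils_map J A b"
proof -
  define M where "M = transpose A ** J ** A"
  define x where "x = ils_map J A b"
  have normal: "transpose A *v (J *v (b - A *v x)) = 0"
    unfolding x_def by (rule ils_normal_equation[OF pos_def_invertible[OF pos]])
  have sym: "u \<bullet> (J *v v) = v \<bullet> (J *v u)" for u v
    by (metis J dot_lmul_matrix inner_commute transpose_matrix_vector)
  have expand: "ils_objective J A b z = ils_objective J A b x + (z - x) \<bullet> (M *v (z - x))" for z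
  proof -
    define d where "d = z - x"
    have z: "b - A *v z = (b - A *v x) - A *v d"
      by (simp add: d_def matrix_vector_mult_diff_distrib)
    have "(A *v d) \<bullet> (J *v (b - A *v x)) = d \<bullet> (transpose A *v (J *v (b - A *v x)))"
      by (rule inner_matrix_vector_transpose)
    then have cross: "(A *v d) \<bullet> (J *v (b - A *v x)) = 0"
      by (simp only: normal inner_zero_right)
    have quad: "(A *v d) \<bullet> (J *v (A *v d)) = d \<bullet> (M *v d)"
      unfolding M_def
      by (simp add: inner_matrix_vector_transpose matrix_vector_mul_assoc matrix_mul_assoc
          del: transpose_matrix_vector)
    show ?thesis
      unfolding ils_objective_def z d_def[symmetric]
      using cross sym[of "b - A *v x" "A *v d"] quad
      by (simp add: matrix_vector_mult_diff_distrib[of J] inner_diff_left inner_diff_right)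
  qed
  have posM: "v \<noteq> 0 \<Longrightarrow> 0 < v \<bullet> (M *v v)" for v
    using pos by (simp add: pos_def_def M_def)
  have "is_arg_min (ils_objective J A b) (\<lambda>_. True) y \<longleftrightarrow> y = x"
  proof
    assume "is_arg_min (ils_objective J A b) (\<lambda>_. True) y"
    then have "\<not> ils_objective J A b x < ils_objective J A b y"
      by (simp add: is_arg_min_def)
    then show "y = x"
      using posM[of "y - x"] by (auto simp: expand[of y])
  next
    assume "y = x"
    moreover have "\<not> ils_objective J A b z < ils_objective J A b x" for z
      using posM[of "z - x"] by (cases "z = x") (auto simp: expand[of z])
    ultimately show "is_arg_min (ils_objective J A b) (\<lambda>_. True) y"
      by (simp add: is_arg_min_def)
  qed
  then show ?thesis
    by (simp only: x_def)
qed

section \<open>Derivative of the solution map\<close>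

lemma has_derivative_ils_map:
  fixes A :: "real^'n^'m" and b :: "real^'m"
  assumes inv: "invertible (transpose A ** J ** A)"
  defines "x \<equiv> ils_map J A b"
  defines "Mi \<equiv> matrix_inv (transpose A ** J ** A)"
  shows "((\<lambda>p. ils_map J (fst p) (snd p)) has_derivative
    (\<lambda>h. Mi *v (transpose (fst h) *v (J *v (b - A *v x)) + transpose A *v (J *v (snd h - fst h *v x)))))
    (at (A, b))"
proof -
  define Q where "Q p = transpose (fst p) ** J ** fst p" for p :: "(real^'n^'m) \<times> (real^'m)"
  \<comment> \<open>\<open>x\<close> stays frozen at the unperturbed solution, so \<open>g\<close>
    is the defect of \<open>x\<close> in the perturbed normal equation and is polynomial in the
    data.\<close>
  define g where "g p = transpose (fst p) *v (J *v (snd p - fst p *v x))" for p :: "(real^'n^'m) \<times> (real^'m)"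
  note mvD = bounded_bilinear.FDERIV[OF bounded_bilinear_matrix_vector_mult]
  have map_eq: "ils_map J (fst p) (snd p) = x + matrix_inv (Q p) *v g p" if "invertible (Q p)" for p
  proof -
    have "g p = transpose (fst p) *v (J *v snd p) - Q p *v x"
      by (simp add: g_def Q_def matrix_vector_mult_diff_distrib matrix_vector_mul_assoc matrix_mul_assoc
        del: transpose_matrix_vector)
    then show ?thesis
      using matrix_inv_self(2)[OF that]
      by (simp add: ils_map_def Q_def[symmetric] matrix_vector_mult_diff_distrib
          matrix_vector_mul_assoc[of "matrix_inv _" "Q p"] del: transpose_matrix_vector)
  qed
  have lim: "((\<lambda>p. Q p) \<longlongrightarrow> Q (A, b)) (at (A, b))"
    unfolding Q_def
    by (intro bounded_bilinear.tendsto[OF bounded_bilinear_matrix_matrix_mult]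
        bounded_linear.tendsto[OF bounded_linear_transpose] tendsto_intros)
  have invQ: "invertible (Q (A, b))"
    using inv by (simp add: Q_def)
  have "g (A, b) = 0"
    unfolding g_def x_def using ils_normal_equation[OF inv] by simp
  moreover have "(g has_derivative (\<lambda>h. transpose A *v (J *v (snd h - fst h *v x))
      + transpose (fst h) *v (J *v (b - A *v x)))) (at (A, b))"
    unfolding g_def
    by (rule has_derivative_eq_rhs, (rule mvD bounded_linear.has_derivative[OF bounded_linear_transpose]
      has_derivative_diff has_derivative_fst has_derivative_snd has_derivative_ident has_derivative_const)+)
     simp
  ultimately have "((\<lambda>p. matrix_inv (Q p) *v g p) has_derivative
      (\<lambda>h. matrix_inv (Q (A, b)) *v (transpose A *v (J *v (snd h - fst h *v x))
        + transpose (fst h) *v (J *v (b - A *v x))))) (at (A, b))"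
    by (intro has_derivative_bilinear_vanishing[OF bounded_bilinear_matrix_vector_mult]
        tendsto_matrix_inv[OF lim invQ])
  from has_derivative_add[OF has_derivative_const this]
  have "((\<lambda>p. x + matrix_inv (Q p) *v g p) has_derivative
      (\<lambda>h. Mi *v (transpose (fst h) *v (J *v (b - A *v x)) + transpose A *v (J *v (snd h - fst h *v x)))))
      (at (A, b))"
    by (simp add: Mi_def Q_def add.commute del: transpose_matrix_vector)
  \<comment> \<open>The identity \<open>map_eq\<close> requires \<open>Q p\<close> to be invertible;
    continuity of the determinant ensures this near \<open>(A, b)\<close>, which is enough for a
    derivative.\<close>
  moreover have "\<forall>\<^sub>F p in at (A, b). x + matrix_inv (Q p) *v g p = ils_map J (fst p) (snd p)"
  proof -
    have "\<forall>\<^sub>F p in at (A, b). det (Q p) \<noteq> 0"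
      using tendsto_imp_eventually_ne[OF tendsto_det[OF lim]] invQ by (simp add: invertible_det_nz)
    then show ?thesis
      by eventually_elim (simp add: map_eq invertible_det_nz)
  qed
  ultimately show ?thesis
    by (rule has_derivative_transform_eventually) (use map_eq[OF invQ] in simp_all)
qed

section \<open>Vectorization and the first formula\<close>

text \<open>The inverse of column stacking: in \<open>(j, l)\<close> the first entry is the column
  and the second the row of the matrix, matching the column index of
  \<open>Gamma_ils\<close>.\<close>

definition unvec :: "real^('n \<times> 'm + 'm) \<Rightarrow> (real^'n::finite^'m::finite) \<times> (real^'m)" where
  "unvec v = ((\<chi> l j. v $ Inl (j, l)), (\<chi> l. v $ Inr l))"

lemma norm_unvec: "norm (unvec v) = norm v"
proof -
  have "(\<Sum>j\<in>UNIV. \<Sum>l\<in>UNIV. (v $ Inl (j, l))\<^sup>2) = (\<Sum>l\<in>UNIV. \<Sum>j\<in>UNIV. (v $ Inl (j, l))\<^sup>2)"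
    by (rule sum.swap)
  then show ?thesis
    by (simp add: unvec_def norm_Pair norm_vec_def L2_set_def sum_UNIV_Plus sum_UNIV_Times sum_nonneg)
qed

lemma surj_unvec: "surj unvec"
proof (rule surjI)
  fix h
  show "unvec (\<chi> s. case s of Inl (j, l) \<Rightarrow> fst h $ l $ j | Inr l \<Rightarrow> snd h $ l) = h"
    by (simp add: unvec_def prod_eq_iff vec_eq_iff)
qed

text \<open>With s = J r and N = M^-1 A^T J, the Kronecker rules are (M^-1 \<otimes> s^T) vec(u) =
  M^-1 u^T s and (x^T \<otimes> N) vec(u) = N u x. They turn the block matrix into the derivative of
  the solution map at a rescaled perturbation.\<close>

lemma block_row_Gamma_ils_mult_vec:
  fixes A :: "real^'n^'m" and J :: "real^'m^'m"
  defines "Mi \<equiv> matrix_inv (transpose A ** J ** A)"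
  shows "block_row (c *\<^sub>R Gamma_ils J A x r) (d *\<^sub>R (Mi ** transpose A ** J)) *v v =
    Mi *v (transpose (c *\<^sub>R fst (unvec v)) *v (J *v r)
      + transpose A *v (J *v (d *\<^sub>R snd (unvec v) - (c *\<^sub>R fst (unvec v)) *v x)))"
proof -
  define N where "N = Mi ** transpose A ** J"
  define s where "s = J *v r"
  define u where "u = fst (unvec v)"
  define w where "w = snd (unvec v)"
  have u: "u $ l $ j = v $ Inl (j, l)" and w: "w $ l = v $ Inr l" for j l
    by (simp_all add: u_def w_def unvec_def)
  have \<Gamma>: "Gamma_ils J A x r $ i $ (j, l) = Mi $ i $ j * s $ l - x $ j * N $ i $ l" for i j l
    by (simp only: Gamma_ils_nth Mi_def N_def s_def)
  have "(block_row (c *\<^sub>R Gamma_ils J A x r) (d *\<^sub>R N) *v v) $ i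
      = (Mi *v (transpose (c *\<^sub>R u) *v s) + N *v (d *\<^sub>R w - (c *\<^sub>R u) *v x)) $ i" for i
  proof -
    \<comment> \<open>The term with \<open>N\<close> sums over the rows of \<open>u\<close>
      outermost, as in N (u x), so only there the order of summation is exchanged.\<close>
    have "(\<Sum>j\<in>UNIV. \<Sum>l\<in>UNIV. c * (Mi $ i $ j * s $ l - x $ j * N $ i $ l) * u $ l $ j)
        = (\<Sum>j\<in>UNIV. \<Sum>l\<in>UNIV. Mi $ i $ j * (c * u $ l $ j * s $ l))
          - (\<Sum>l\<in>UNIV. \<Sum>j\<in>UNIV. N $ i $ l * (c * u $ l $ j * x $ j))"
      by (subst (3) sum.swap) (simp add: sum_subtractf[symmetric] algebra_simps)
    moreover have "(block_row (c *\<^sub>R Gamma_ils J A x r) (d *\<^sub>R N) *v v) $ i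
        = (\<Sum>j\<in>UNIV. \<Sum>l\<in>UNIV. c * (Mi $ i $ j * s $ l - x $ j * N $ i $ l) * u $ l $ j)
          + (\<Sum>l\<in>UNIV. d * N $ i $ l * w $ l)"
      by (simp add: matrix_vector_mult_def block_row_def sum_UNIV_Plus sum_UNIV_Times \<Gamma> u w)
    moreover have "(Mi *v (transpose (c *\<^sub>R u) *v s) + N *v (d *\<^sub>R w - (c *\<^sub>R u) *v x)) $ i
        = (\<Sum>j\<in>UNIV. \<Sum>l\<in>UNIV. Mi $ i $ j * (c * u $ l $ j * s $ l))
          - (\<Sum>l\<in>UNIV. \<Sum>j\<in>UNIV. N $ i $ l * (c * u $ l $ j * x $ j))
          + (\<Sum>l\<in>UNIV. d * N $ i $ l * w $ l)"
      by (simp add: matrix_vector_mult_def transpose_def sum_distrib_left right_diff_distrib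
          sum_subtractf mult_ac del: transpose_matrix_vector)
    ultimately show ?thesis
      by simp
  qed
  then show ?thesis
    by (simp add: vec_eq_iff N_def[symmetric] s_def[symmetric] u_def[symmetric] w_def[symmetric]
        matrix_vector_right_distrib matrix_vector_mul_assoc matrix_mul_assoc
        del: transpose_matrix_vector)
qed

lemma projected_cond_ils_eq_spectral_norm:
  fixes A :: "real^'n^'m" and b :: "real^'m" and J :: "real^'m^'m" and L :: "real^'k^'n"
  assumes inv: "invertible (transpose A ** J ** A)"
    and pos: "\<Phi> > 0" "\<beta> > 0" "\<xi> > 0"
  defines "x \<equiv> ils_map J A b"
  defines "Mi \<equiv> matrix_inv (transpose A ** J ** A)"
  shows "projected_cond_ils \<Phi> \<beta> \<xi> L J A b = ereal (spectral_norm (\<xi> *\<^sub>R (transpose L **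
    block_row ((1 / \<Phi>) *\<^sub>R Gamma_ils J A x (b - A *v x)) ((1 / \<beta>) *\<^sub>R (Mi ** transpose A ** J)))))"
    (is "_ = ereal (spectral_norm ?K)")
proof -
  \<comment> \<open>Dividing by the weights makes the weighted norm of \<open>scale h\<close> the
    Euclidean norm of the pair \<open>h\<close>.\<close>
  define scale where "scale h = ((1 / \<Phi>) *\<^sub>R fst h, (1 / \<beta>) *\<^sub>R snd h)"
    for h :: "(real^'n^'m) \<times> (real^'m)"
  define G where "G h = \<xi> *\<^sub>R (transpose L *v ils_map J (fst ((A, b) + scale h)) (snd ((A, b) + scale h)))" for h
  define D where "D h = \<xi> *\<^sub>R (transpose L *v (Mi *v (transpose (fst (scale h)) *v (J *v (b - A *v x))
    + transpose A *v (J *v (snd (scale h) - fst (scale h) *v x)))))" for h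
  have "((\<lambda>h. (A, b) + scale h) has_derivative scale) (at 0)"
    unfolding scale_def by (auto intro!: derivative_eq_intros)
  then have "((\<lambda>h. ils_map J (fst ((A, b) + scale h)) (snd ((A, b) + scale h))) has_derivative
      (\<lambda>h. Mi *v (transpose (fst (scale h)) *v (J *v (b - A *v x))
        + transpose A *v (J *v (snd (scale h) - fst (scale h) *v x))))) (at 0)"
    by (rule has_derivative_compose) (use has_derivative_ils_map[OF inv, of b] in
      \<open>simp add: scale_def x_def Mi_def zero_prod_def[symmetric] del: transpose_matrix_vector\<close>)
  then have "(G has_derivative D) (at 0)"
    unfolding G_def D_def
    by (intro has_derivative_scaleR_right bounded_linear.has_derivative[OF matrix_vector_mul_bounded_linear])
  from SUP_difference_quotient_tendsto_onorm[OF this]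
  have lim: "((\<lambda>\<delta>. SUP h\<in>{h. 0 < norm h \<and> norm h \<le> \<delta>}. ereal (norm (G h - G 0) / norm h))
      \<longlongrightarrow> ereal (onorm D)) (at_right 0)"
    by simp
  have wn: "weighted_norm \<Phi> \<beta> (fst (scale h)) (snd (scale h)) = norm h" for h
    using pos by (cases h) (simp add: weighted_norm_def scale_def norm_Pair power_divide)
  have surj_scale: "surj scale"
  proof (rule surjI)
    show "scale (\<Phi> *\<^sub>R fst h, \<beta> *\<^sub>R snd h) = h" for h
      using pos by (simp add: scale_def)
  qed
  \<comment> \<open>The admissible perturbations are the image of a punctured ball, so the supremum
    can be taken over \<open>h\<close>.\<close>
  have "{(dA, db). 0 < weighted_norm \<Phi> \<beta> dA db \<and> weighted_norm \<Phi> \<beta> dA db \<le> \<delta>}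
      = scale ` {h. 0 < norm h \<and> norm h \<le> \<delta>}" for \<delta>
  proof (intro equalityI subsetI)
    fix p assume p: "p \<in> {(dA, db). 0 < weighted_norm \<Phi> \<beta> (dA :: real^'n^'m) db \<and> weighted_norm \<Phi> \<beta> dA db \<le> \<delta>}"
    obtain h where "p = scale h"
      using surj_scale by blast
    with p wn[of h] show "p \<in> scale ` {h. 0 < norm h \<and> norm h \<le> \<delta>}"
      by (auto simp: case_prod_unfold)
  qed (auto simp: case_prod_unfold wn)
  then have "projected_cond_ils \<Phi> \<beta> \<xi> L J A b = Lim (at_right 0)
      (\<lambda>\<delta>. SUP h\<in>{h. 0 < norm h \<and> norm h \<le> \<delta>}. ereal (norm (G h - G 0) / norm h))"
    using pos
    by (simp add: projected_cond_ils_def image_image case_prod_unfold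
        wn[unfolded scale_def fst_conv snd_conv] G_def
        scaleR_diff_right[symmetric] scale_def zero_prod_def[symmetric] del: transpose_matrix_vector)
  also have "\<dots> = ereal (onorm D)"
    using lim by (intro tendsto_Lim) auto
  also have "onorm D = onorm (\<lambda>v. D (unvec v))"
    by (rule onorm_compose_isometry[OF surj_unvec norm_unvec, symmetric])
  \<comment> \<open>In vectorized coordinates the derivative is multiplication by the block matrix,
    and its operator norm is a spectral norm.\<close>
  also have "(\<lambda>v. D (unvec v)) = (*v) ?K"
    by (rule ext) (simp add: D_def scale_def Mi_def block_row_Gamma_ils_mult_vec
        matrix_vector_mul_assoc[symmetric] scaleR_matrix_vector_assoc[symmetric]
        del: transpose_matrix_vector)
  finally show ?thesis
    by (simp add: spectral_norm_def)
qed

section \<open>Gram matrices and the other two formulas\<close>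

text \<open>For the form with the projector, where M^-1 stands outside the block row. The next lemma
  is for the Kronecker form, whose block row contains M^-1.\<close>

lemma spectral_norm_transpose_mult_mult_eq_sqrt:
  fixes L :: "real^'k^'n" and Mi :: "real^'n^'n" and W :: "real^'l^'n"
  assumes "transpose Mi = Mi"
  shows "spectral_norm (\<xi> *\<^sub>R (transpose L ** Mi ** W)) =
    sqrt (spectral_norm (\<xi>\<^sup>2 *\<^sub>R (transpose L ** Mi ** (W ** transpose W) ** Mi ** L)))"
  by (subst spectral_norm_eq_sqrt)
    (simp add: transpose_scalar matrix_transpose_mul assms scalar_matrix_assoc[symmetric]
      matrix_scalar_ac power2_eq_square matrix_mul_assoc)

lemma spectral_norm_transpose_mult_eq_sqrt:
  fixes L :: "real^'k^'n" and Mi :: "real^'n^'n" and W :: "real^'l^'n"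
  assumes "W ** transpose W = Mi ** S ** Mi"
  shows "spectral_norm (\<xi> *\<^sub>R (transpose L ** W)) =
    sqrt (spectral_norm (\<xi>\<^sup>2 *\<^sub>R (transpose L ** Mi ** S ** Mi ** L)))"
proof -
  have "transpose L ** W ** transpose W ** L = transpose L ** Mi ** S ** Mi ** L"
    using assms by (metis matrix_mul_assoc)
  then show ?thesis
    by (subst spectral_norm_eq_sqrt)
      (simp add: transpose_scalar matrix_transpose_mul scalar_matrix_assoc[symmetric]
        matrix_scalar_ac power2_eq_square matrix_mul_assoc)
qed

lemma block_row_Gamma_ils_mult_transpose:
  fixes A :: "real^'n^'m" and J :: "real^'m^'m" and x :: "real^'n" and r :: "real^'m"
  assumes J: "transpose J = J" "J ** J = mat 1"
    and Mi: "transpose (matrix_inv (transpose A ** J ** A)) = matrix_inv (transpose A ** J ** A)"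
    and nz: "\<Phi> \<noteq> 0" "\<beta> \<noteq> 0"
  defines "Mi \<equiv> matrix_inv (transpose A ** J ** A)"
  defines "W \<equiv> block_row ((1 / \<Phi>) *\<^sub>R Gamma_ils J A x r) ((1 / \<beta>) *\<^sub>R (Mi ** transpose A ** J))"
  shows "W ** transpose W =
    Mi ** (((\<beta>\<^sup>2 * (norm x)\<^sup>2 + \<Phi>\<^sup>2) / (\<Phi>\<^sup>2 * \<beta>\<^sup>2)) *\<^sub>R (transpose A ** A) + ((norm r)\<^sup>2 / \<Phi>\<^sup>2) *\<^sub>R mat 1
      - (1 / \<Phi>\<^sup>2) *\<^sub>R (outer x r ** A + transpose A ** outer r x)) ** Mi"
proof -
  define N where "N = Mi ** transpose A ** J"
  define C where "C = transpose A ** A"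
  define E where "E = outer x r ** A"
  define E' where "E' = transpose A ** outer r x"
  define G where "G = Gamma_ils J A x r"
  have tMi: "transpose Mi = Mi"
    using Mi by (simp add: Mi_def)
  \<comment> \<open>A symmetric involution is orthogonal, so J preserves the norm of r.\<close>
  have "(J *v r) \<bullet> (J *v r) = r \<bullet> ((J ** J) *v r)"
    by (metis J(1) inner_matrix_vector_transpose matrix_vector_mul_assoc)
  then have normJ: "norm (J *v r) = norm r"
    by (simp add: norm_eq_sqrt_inner J)
  have NN: "N ** transpose N = Mi ** C ** Mi"
  proof -
    have "N ** transpose N = Mi ** transpose A ** (J ** J) ** A ** Mi"
      by (simp add: N_def C_def matrix_transpose_mul tMi J(1) matrix_mul_assoc)
    then show ?thesis
      by (simp add: J(2) C_def matrix_mul_assoc)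
  qed
  have NJ: "N *v (J *v r) = Mi *v (transpose A *v r)"
  proof -
    have "N *v (J *v r) = (Mi ** transpose A ** (J ** J)) *v r"
      by (simp add: N_def matrix_vector_mul_assoc matrix_mul_assoc del: transpose_matrix_vector)
    then show ?thesis
      by (simp add: J(2) matrix_vector_mul_assoc del: transpose_matrix_vector)
  qed
  have vMi: "v v* Mi = Mi *v v" for v
    by (metis tMi transpose_matrix_vector)
  have E: "outer (Mi *v x) (N *v (J *v r)) = Mi ** E ** Mi"
    by (simp add: NJ E_def matrix_mult_outer outer_mult_matrix vMi)
  have E': "outer (N *v (J *v r)) (Mi *v x) = Mi ** E' ** Mi"
    by (simp add: NJ E'_def matrix_mult_outer outer_mult_matrix vMi)
  have GG: "G ** transpose G = (norm r)\<^sup>2 *\<^sub>R (Mi ** Mi) - Mi ** E ** Mi - Mi ** E' ** Mi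
      + (norm x)\<^sup>2 *\<^sub>R (Mi ** C ** Mi)"
    using kron_difference_mult_transpose[of G Mi "J *v r" x N]
    by (simp add: G_def Gamma_ils_nth Mi_def[symmetric] N_def[symmetric] normJ E E' NN tMi)
  have WW: "W ** transpose W = (1 / \<Phi>\<^sup>2) *\<^sub>R (G ** transpose G) + (1 / \<beta>\<^sup>2) *\<^sub>R (Mi ** C ** Mi)"
    by (simp add: W_def block_row_mult_transpose transpose_scalar scalar_matrix_assoc[symmetric]
        matrix_scalar_ac G_def[symmetric] N_def[symmetric] NN power2_eq_square)
  \<comment> \<open>Both blocks contribute M^-1 A^T A M^-1: the Kronecker block with |x|^2 /
    \<Phi>^2, the other with 1 / \<beta>^2. Their sum is the origin of
    \<open>\<zeta>\<close>.\<close>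
  have coeff: "(\<beta>\<^sup>2 * (norm x)\<^sup>2 + \<Phi>\<^sup>2) / (\<Phi>\<^sup>2 * \<beta>\<^sup>2) = (norm x)\<^sup>2 / \<Phi>\<^sup>2 + 1 / \<beta>\<^sup>2"
    using nz by (simp add: field_simps)
  show ?thesis
    unfolding WW GG coeff C_def[symmetric] E_def[symmetric] E'_def[symmetric]
    by (simp add: matrix_add_ldistrib matrix_add_rdistrib matrix_diff_ldistrib matrix_diff_rdistrib
        scalar_matrix_assoc[symmetric] matrix_scalar_ac scaleR_add_left scaleR_add_right
        scaleR_diff_right)
qed

text \<open>The first block yields A^T A and the mixed terms, but also a surplus multiple of x x^T.
  The projector block subtracts exactly that multiple, and its identity part joins the middle block
  to give |r|^2 / \<Phi>^2.\<close>

lemma block_row_projector_mult_transpose: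
  fixes A :: "real^'n^'m" and x :: "real^'n" and r :: "real^'m"
  assumes x: "x \<noteq> 0" and pos: "\<Phi> > 0" "\<beta> > 0"
    and \<zeta>: "\<zeta> = sqrt (\<beta>\<^sup>2 * (norm x)\<^sup>2 + \<Phi>\<^sup>2)"
  defines "W \<equiv> block_row ((\<zeta> / (\<Phi> * \<beta>)) *\<^sub>R transpose A - (\<beta> / (\<zeta> * \<Phi>)) *\<^sub>R outer x r)
    (block_row ((norm r / \<zeta>) *\<^sub>R mat 1) ((\<beta> * norm r * norm x / (\<zeta> * \<Phi>)) *\<^sub>R complement_projector x))"
  shows "W ** transpose W = (\<zeta>\<^sup>2 / (\<Phi>\<^sup>2 * \<beta>\<^sup>2)) *\<^sub>R (transpose A ** A) + ((norm r)\<^sup>2 / \<Phi>\<^sup>2) *\<^sub>R mat 1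
    - (1 / \<Phi>\<^sup>2) *\<^sub>R (outer x r ** A + transpose A ** outer r x)"
proof -
  define E where "E = outer x r ** A"
  define E' where "E' = transpose A ** outer r x"
  define c d e f where "c = \<zeta> / (\<Phi> * \<beta>)" and "d = \<beta> / (\<zeta> * \<Phi>)" and "e = norm r / \<zeta>"
    and "f = \<beta> * norm r * norm x / (\<zeta> * \<Phi>)"
  have \<zeta>2: "\<zeta>\<^sup>2 = \<beta>\<^sup>2 * (norm x)\<^sup>2 + \<Phi>\<^sup>2"
    by (simp add: \<zeta>)
  have "\<zeta> > 0"
    using pos by (simp add: \<zeta> add_nonneg_pos)
  have "W ** transpose W = c\<^sup>2 *\<^sub>R (transpose A ** A) - (c * d) *\<^sub>R E - (c * d) *\<^sub>R E'
      + (d\<^sup>2 * (norm r)\<^sup>2) *\<^sub>R outer x x + e\<^sup>2 *\<^sub>R mat 1 + f\<^sup>2 *\<^sub>R complement_projector x"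
    unfolding W_def c_def[symmetric] d_def[symmetric] e_def[symmetric] f_def[symmetric]
    by (simp add: block_row_mult_transpose transpose_scalar transpose_diff transpose_outer
        matrix_diff_ldistrib matrix_diff_rdistrib scalar_matrix_assoc[symmetric] matrix_scalar_ac
        complement_projector_mult_transpose[OF x] outer_mult_outer E_def E'_def
        dot_square_norm[of r] power2_eq_square scaleR_diff_right mult_ac)
  also have "\<dots> = c\<^sup>2 *\<^sub>R (transpose A ** A) - (c * d) *\<^sub>R (E + E')
      + (d\<^sup>2 * (norm r)\<^sup>2 - f\<^sup>2 / (norm x)\<^sup>2) *\<^sub>R outer x x + (e\<^sup>2 + f\<^sup>2) *\<^sub>R mat 1"
    by (simp add: complement_projector_def algebra_simps)
  \<comment> \<open>Both terms equal \<beta>^2 |r|^2 / (\<zeta>^2 \<Phi>^2).\<close>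
  also have "d\<^sup>2 * (norm r)\<^sup>2 - f\<^sup>2 / (norm x)\<^sup>2 = 0"
    using x by (simp add: d_def f_def power_divide power_mult_distrib)
  also have "c * d = 1 / \<Phi>\<^sup>2"
    using pos \<open>\<zeta> > 0\<close> by (simp add: c_def d_def power2_eq_square)
  also have "e\<^sup>2 + f\<^sup>2 = (norm r)\<^sup>2 / \<Phi>\<^sup>2"
  proof -
    \<comment> \<open>Over the common denominator the numerator contains \<zeta>^2, which then
      cancels.\<close>
    have "e\<^sup>2 + f\<^sup>2 = (norm r)\<^sup>2 * (\<beta>\<^sup>2 * (norm x)\<^sup>2 + \<Phi>\<^sup>2) / (\<zeta>\<^sup>2 * \<Phi>\<^sup>2)"
      using pos \<open>\<zeta> > 0\<close> by (simp add: e_def f_def field_simps power2_eq_square)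
    then show ?thesis
      using \<open>\<zeta> > 0\<close> by (simp add: \<zeta>2[symmetric])
  qed
  also have "c\<^sup>2 = \<zeta>\<^sup>2 / (\<Phi>\<^sup>2 * \<beta>\<^sup>2)"
    by (simp add: c_def power_divide power_mult_distrib)
  finally show ?thesis
    by (simp add: E_def E'_def)
qed

theorem theorem4p1:
  fixes A :: "real^'n^'m::{finite,wellorder}" and b :: "real^'m::_"
    and L :: "real^'k^'n"
    and J :: "real^'m::_^'m::_" and M :: "real^'n^'n"
    and x :: "real^'n" and r :: "real^'m::_"
    and p q :: nat and \<Phi> \<beta> \<xi> \<zeta> :: real
  assumes pq: "p + q = CARD('m::_)"
    and J: "J = signature_matrix p"
    and M: "M = transpose A ** J ** A"
    and pos: "pos_def M"
    and x: "x = matrix_inv M *v (transpose A *v (J *v b))"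
    and r: "r = b - A *v x"
    and L: "rank L = CARD('k)"
    and \<Phi>: "\<Phi> > 0" and \<beta>: "\<beta> > 0" and \<xi>: "\<xi> > 0"
    and \<zeta>: "\<zeta> = sqrt (\<beta>\<^sup>2 * (norm x)\<^sup>2 + \<Phi>\<^sup>2)"
  shows "(\<forall>y. is_arg_min (ils_objective J A b) (\<lambda>_. True) y \<longleftrightarrow> y = x)
    \<and> projected_cond_ils \<Phi> \<beta> \<xi> L J A b
        = ereal (spectral_norm (\<xi> *\<^sub>R (transpose L **
            block_row ((1 / \<Phi>) *\<^sub>R Gamma_ils J A x r)
                      ((1 / \<beta>) *\<^sub>R (matrix_inv M ** transpose A ** J)))))
    \<and> projected_cond_ils \<Phi> \<beta> \<xi> L J A b
        = ereal (sqrt (spectral_norm (\<xi>\<^sup>2 *\<^sub>R (transpose L ** matrix_inv M **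
            ((\<zeta>\<^sup>2 / (\<Phi>\<^sup>2 * \<beta>\<^sup>2)) *\<^sub>R (transpose A ** A)
              + ((norm r)\<^sup>2 / \<Phi>\<^sup>2) *\<^sub>R mat 1
              - (1 / \<Phi>\<^sup>2) *\<^sub>R (outer x r ** A + transpose A ** outer r x))
            ** matrix_inv M ** L))))
    \<and> (x \<noteq> 0 \<longrightarrow> projected_cond_ils \<Phi> \<beta> \<xi> L J A b
        = ereal (spectral_norm (\<xi> *\<^sub>R (transpose L ** matrix_inv M **
            block_row ((\<zeta> / (\<Phi> * \<beta>)) *\<^sub>R transpose A - (\<beta> / (\<zeta> * \<Phi>)) *\<^sub>R outer x r)
              (block_row ((norm r / \<zeta>) *\<^sub>R mat 1)
                         ((\<beta> * norm r * norm x / (\<zeta> * \<Phi>)) *\<^sub>R complement_projector x))))))"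
    (is "?argmin \<and> ?\<kappa> = ereal ?K \<and> ?\<kappa> = ereal (sqrt (spectral_norm (\<xi>\<^sup>2 *\<^sub>R (_ ** ?S ** _ ** _)))) \<and> _")
proof -
  have tJ: "transpose J = J" and JJ: "J ** J = mat 1"
    by (simp_all add: J transpose_signature_matrix signature_matrix_involution)
  have inv: "invertible M"
    using pos by (rule pos_def_invertible)
  have tMi: "transpose (matrix_inv M) = matrix_inv M"
    using transpose_matrix_inv[OF inv] pos by (simp add: pos_def_def)
  have x': "x = ils_map J A b"
    by (simp add: x M ils_map_def)
  have \<zeta>2: "\<zeta>\<^sup>2 = \<beta>\<^sup>2 * (norm x)\<^sup>2 + \<Phi>\<^sup>2"
    by (simp add: \<zeta>)
  have argmin: ?argmin
    using is_arg_min_ils_objective_iff[OF tJ pos[unfolded M]] by (simp add: x')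
  have K: "?\<kappa> = ereal ?K"
    using projected_cond_ils_eq_spectral_norm[OF inv[unfolded M] \<Phi> \<beta> \<xi>] by (simp add: x' r M)
  \<comment> \<open>The block row in \<open>?K\<close> has Gram matrix M^-1 S M^-1, with
    \<open>?S\<close> for S. The block row with the projector has Gram matrix S and is multiplied by
    M^-1 afterwards, so both norms reduce to the same square root.\<close>
  have "?K = sqrt (spectral_norm (\<xi>\<^sup>2 *\<^sub>R (transpose L ** matrix_inv M ** ?S ** matrix_inv M ** L)))"
    unfolding \<zeta>2 M
    by (intro spectral_norm_transpose_mult_eq_sqrt block_row_Gamma_ils_mult_transpose tJ JJ tMi[unfolded M])
      (use \<Phi> \<beta> in simp_all)
  moreover have "x \<noteq> 0 \<Longrightarrow> spectral_norm (\<xi> *\<^sub>R (transpose L ** matrix_inv M **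
      block_row ((\<zeta> / (\<Phi> * \<beta>)) *\<^sub>R transpose A - (\<beta> / (\<zeta> * \<Phi>)) *\<^sub>R outer x r)
        (block_row ((norm r / \<zeta>) *\<^sub>R mat 1) ((\<beta> * norm r * norm x / (\<zeta> * \<Phi>)) *\<^sub>R complement_projector x))))
      = sqrt (spectral_norm (\<xi>\<^sup>2 *\<^sub>R (transpose L ** matrix_inv M ** ?S ** matrix_inv M ** L)))"
    using spectral_norm_transpose_mult_mult_eq_sqrt[OF tMi] block_row_projector_mult_transpose[OF _ \<Phi> \<beta> \<zeta>] by metis
  ultimately show ?thesis
    using argmin K by simp
qed

end
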